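(* Let $\Gamma = (V,E)$ and $\Sigma = (W,F)$ be two finite connected simple graphs with the same number of vertices and the same number of edges, i.e. $|V| = |W|$ and $|E| = |F|$. Let $\psi : V \to W$ be any bijection between the vertex sets. Then there exists a finite sequence of edge slides which transforms $\Gamma$ into a graph $\widetilde{\Gamma} = (V, \widetilde{E})$ on the same vertex set $V$ such that $\psi : \widetilde{\Gamma} \to \Sigma$ is an isomorphism of graphs, i.e. for all $x,y \in V$, $x$ and $y$ are adjacent in $\widetilde{\Gamma}$ if and only if $\psi(x)$ and $\psi(y)$ are adjacent in $\Sigma$.
   Context: A simple graph $\Gamma = (V,E)$ has no loops and no double edges; write $\overline{xy}$ for the edge joining $x$ and $y$, and $x \sim y$ if $\overline{xy} \in E$. An (edge) slide is the following operation: given three distinct vertices $x,y,z \in V$ with $x \sim y \sim z$ and $x \not\sim z$, replace the edge $\overline{xy}$ by the edge $\overline{xz}$, so that the new graph is $(V, (E \setminus \{\overline{xy}\}) \cup \{\overline{xz}\})$. (This is the slide along $\overline{yz}$ with pivot $x$; exchanging the roles of $x$ and $z$ gives the slide along $\overline{xy}$ with pivot $z$, which replaces $\overline{yz}$ by $\overline{xz}$.) A finite sequence of slides may be empty. *)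

theory Defs
  imports Main
begin

text \<open>
  A simple graph is given by its vertex set and its edge set; the edge joining \<open>x\<close> and \<open>y\<close> is the
  two-element set \<open>{x, y}\<close>.
\<close>

definition simple_graph :: "'a set \<Rightarrow> 'a set set \<Rightarrow> bool" where
  "simple_graph V E \<longleftrightarrow> E \<subseteq> {{x, y} |x y. x \<in> V \<and> y \<in> V \<and> x \<noteq> y}"

definition adj :: "'a set set \<Rightarrow> 'a \<Rightarrow> 'a \<Rightarrow> bool" where
  "adj E x y \<longleftrightarrow> {x, y} \<in> E"

text \<open>
  The reflexive transitive closure of \<open>adj E\<close> relates the endpoints of walks. The graph with no vertices
  counts as connected.
\<close>

definition connected_graph :: "'a set \<Rightarrow> 'a set set \<Rightarrow> bool" where
  "connected_graph V E \<longleftrightarrow> (\<forall>x\<in>V. \<forall>y\<in>V. (adj E)\<^sup>*\<^sup>* x y)"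

definition finite_connected_simple_graph :: "'a set \<Rightarrow> 'a set set \<Rightarrow> bool" where
  "finite_connected_simple_graph V E \<longleftrightarrow> finite V \<and> simple_graph V E \<and> connected_graph V E"

text \<open>
  The slide along \<open>{y, z}\<close> with pivot \<open>x\<close>. The vertex set is unchanged, so a slide is a relation
  between edge sets on \<open>V\<close>.
\<close>

inductive slide :: "'a set \<Rightarrow> 'a set set \<Rightarrow> 'a set set \<Rightarrow> bool" for V :: "'a set" where
  "\<lbrakk>x \<in> V; y \<in> V; z \<in> V; distinct [x, y, z]; adj E x y; adj E y z; \<not> adj E x z\<rbrakk>
    \<Longrightarrow> slide V E ((E - {{x, y}}) \<union> {{x, z}})"

definition graph_iso :: "('a \<Rightarrow> 'b) \<Rightarrow> 'a set \<Rightarrow> 'a set set \<Rightarrow> 'b set \<Rightarrow> 'b set set \<Rightarrow> bool" where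
  "graph_iso \<psi> V E W F \<longleftrightarrow>
     bij_betw \<psi> V W \<and> (\<forall>x\<in>V. \<forall>y\<in>V. adj E x y \<longleftrightarrow> adj F (\<psi> x) (\<psi> y))"

end

theory Submission
  imports Defs
begin

text \<open>
  Slides are reversible and preserve connectedness and the number of edges, so it suffices to join
  two connected graphs on the same vertex set through a normal form. Fix a vertex \<open>v\<close>. If \<open>v\<close> is not
  adjacent to every other vertex, then some \<open>x\<close> is at distance two from \<open>v\<close>, say \<open>v \<sim> y \<sim> x\<close>, and
  sliding \<open>{x, y}\<close> to \<open>{x, v}\<close> raises the degree of \<open>v\<close>; hence \<open>v\<close> can be made adjacent to all other
  vertices. In such a graph two slides through \<open>v\<close> move an edge \<open>{x, y}\<close> avoiding \<open>v\<close> to any non-edge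
  \<open>{x, z}\<close>, so the edges avoiding \<open>v\<close> can be rearranged at will.
\<close>

section \<open>Edges of simple graphs\<close>

lemma adj_commute: "adj E x y \<longleftrightarrow> adj E y x"
  by (simp add: adj_def insert_commute)

lemma simple_graph_edgeE:
  assumes "simple_graph V E" and "e \<in> E"
  obtains x y where "e = {x, y}" "x \<in> V" "y \<in> V" "x \<noteq> y"
  using assms unfolding simple_graph_def by blast

lemma simple_graph_adjD:
  assumes "simple_graph V E" and "adj E x y"
  shows "x \<in> V" "y \<in> V" "x \<noteq> y"
  using assms unfolding adj_def by (auto elim!: simple_graph_edgeE simp: doubleton_eq_iff)

lemma simple_graph_finite:
  assumes "finite V" and "simple_graph V E"
  shows "finite E"
proof -
  have "E \<subseteq> Pow V"
    using assms(2) unfolding simple_graph_def by auto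
  then show ?thesis
    using assms(1) by (meson finite_Pow_iff finite_subset)
qed

section \<open>Reversibility and invariants of slides\<close>

lemma slide_sym:
  assumes "slide V E E'"
  shows "slide V E' E"
  using assms
proof cases
  case (1 x y z)
  let ?E = "(E' - {{x, z}}) \<union> {{x, y}}"
  \<comment> \<open>After the slide, \<open>x\<close> \<sim> \<open>z\<close> \<sim>
    \<open>y\<close> and \<open>x\<close> is no longer adjacent to \<open>y\<close>, so the same
    pivot can slide back along \<open>{y, z}\<close>.\<close>
  have "slide V E' ?E"
    by (rule slide.intros) (use 1 in \<open>auto simp: adj_def doubleton_eq_iff insert_commute\<close>)
  moreover have "?E = E"
    using 1 by (auto simp: adj_def)
  ultimately show ?thesis
    by simp
qed

lemma slides_sym:
  assumes "(slide V)\<^sup>*\<^sup>* E E'"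
  shows "(slide V)\<^sup>*\<^sup>* E' E"
  using assms by (metis slide_sym symp_rtranclp sympD sympI)

text \<open>Replacing each edge of an \<open>E\<close>-walk by an \<open>E'\<close>-walk and
  concatenating reduces connectedness to a check on single edges.\<close>

lemma connected_graph_mono_walks:
  assumes "connected_graph V E"
    and "\<And>a b. adj E a b \<Longrightarrow> (adj E')\<^sup>*\<^sup>* a b"
  shows "connected_graph V E'"
proof -
  have "(adj E')\<^sup>*\<^sup>* a b" if "(adj E)\<^sup>*\<^sup>* a b" for a b
    using that by induction (auto dest: assms(2))
  then show ?thesis
    using assms(1) unfolding connected_graph_def by blast
qed

lemma slide_simple:
  assumes "slide V E E'" and "simple_graph V E"
  shows "simple_graph V E'"
  using assms by cases (auto simp: simple_graph_def)

lemma slide_connected: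
  assumes "slide V E E'" and "connected_graph V E"
  shows "connected_graph V E'"
  using assms(1)
proof cases
  case (1 x y z)
  have "adj E' x z" "adj E' y z"
    using 1 by (auto simp: adj_def doubleton_eq_iff)
  \<comment> \<open>Only \<open>{x, y}\<close> is lost, and the walk through \<open>z\<close>
    bypasses it.\<close>
  then have xy: "(adj E')\<^sup>*\<^sup>* x y" "(adj E')\<^sup>*\<^sup>* y x"
    by (meson adj_commute converse_rtranclp_into_rtranclp r_into_rtranclp)+
  have "(adj E')\<^sup>*\<^sup>* a b" if "adj E a b" for a b
  proof (cases "{a, b} = {x, y}")
    case True
    then show ?thesis
      using xy by (auto simp: doubleton_eq_iff)
  next
    case False
    then have "adj E' a b"
      using that 1 by (auto simp: adj_def)
    then show ?thesis ..
  qed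
  then show ?thesis
    by (rule connected_graph_mono_walks[OF assms(2)])
qed

lemma slide_card:
  assumes "slide V E E'" and "finite E"
  shows "card E' = card E"
  using assms(1)
proof cases
  case (1 x y z)
  then have "card E' = Suc (card (E - {{x, y}}))"
    using assms(2) by (simp add: adj_def)
  also have "\<dots> = card E"
    using 1 assms(2) by (intro card_Suc_Diff1) (auto simp: adj_def)
  finally show ?thesis .
qed

lemma slides_invariants:
  assumes "(slide V)\<^sup>*\<^sup>* E E'" and "finite_connected_simple_graph V E"
  shows "finite_connected_simple_graph V E' \<and> card E' = card E"
  using assms
proof (induction rule: rtranclp_induct)
  case (step E1 E2)
  then show ?case
    using slide_simple slide_connected slide_card simple_graph_finite
    unfolding finite_connected_simple_graph_def by metis
qed auto

section \<open>Making a vertex adjacent to all others\<close>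

lemma exists_distance_two:
  assumes "connected_graph V E" and "simple_graph V E"
    and "v \<in> V" "w \<in> V" "w \<noteq> v" "\<not> adj E v w"
  obtains x y where "adj E v y" "adj E y x" "x \<noteq> v" "\<not> adj E v x"
proof -
  have "(adj E)\<^sup>*\<^sup>* v w"
    using assms unfolding connected_graph_def by blast
  \<comment> \<open>Invariant along a walk from \<open>v\<close>: as long as no witness has
    appeared, the walk stays within \<open>v\<close> and its neighbours.\<close>
  then have "w = v \<or> adj E v w \<or> (\<exists>x y. adj E v y \<and> adj E y x \<and> x \<noteq> v \<and> \<not> adj E v x)"
    by induction blast+
  then show ?thesis
    using assms that by blast
qed

definition dominating :: "'a set \<Rightarrow> 'a set set \<Rightarrow> 'a \<Rightarrow> bool" where
  "dominating V E v \<longleftrightarrow> (\<forall>w\<in>V. w \<noteq> v \<longrightarrow> adj E v w)"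

text \<open>Induction on the number of vertices other than \<open>v\<close> that are not adjacent to
  \<open>v\<close>.\<close>

lemma slides_to_dominating:
  assumes "finite_connected_simple_graph V E" and "v \<in> V"
  shows "\<exists>E'. (slide V)\<^sup>*\<^sup>* E E' \<and> dominating V E' v"
  using assms(1)
proof (induction "card {w \<in> V. w \<noteq> v \<and> \<not> adj E v w}" arbitrary: E rule: less_induct)
  case less
  note E = less.prems[unfolded finite_connected_simple_graph_def]
  show ?case
  proof (cases "dominating V E v")
    case False
    then obtain w where "w \<in> V" "w \<noteq> v" "\<not> adj E v w"
      unfolding dominating_def by blast
    then obtain x y where xy: "adj E v y" "adj E y x" "x \<noteq> v" "\<not> adj E v x"
      using exists_distance_two[of V E v w] E \<open>v \<in> V\<close> by blast
    have mem: "x \<in> V" "y \<in> V" "x \<noteq> y" "y \<noteq> v"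
      using simple_graph_adjD[OF _ xy(1), of V] simple_graph_adjD[OF _ xy(2), of V] E by auto
    define E1 where "E1 = (E - {{x, y}}) \<union> {{x, v}}"
    have slide: "slide V E E1"
      unfolding E1_def
      by (rule slide.intros) (use xy mem \<open>v \<in> V\<close> in \<open>auto simp: adj_commute\<close>)
    \<comment> \<open>The removed edge \<open>{x, y}\<close> avoids \<open>v\<close>, so
      \<open>v\<close> loses no neighbour.\<close>
    have mono: "adj E1 v u" if "adj E v u" for u
      using that xy mem by (auto simp: E1_def adj_def doubleton_eq_iff)
    have new: "adj E1 v x"
      by (auto simp: E1_def adj_def insert_commute)
    have "{w \<in> V. w \<noteq> v \<and> \<not> adj E1 v w} \<subset> {w \<in> V. w \<noteq> v \<and> \<not> adj E v w}"
      using mono new xy mem by blast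
    then have "card {w \<in> V. w \<noteq> v \<and> \<not> adj E1 v w} < card {w \<in> V. w \<noteq> v \<and> \<not> adj E v w}"
      using E by (intro psubset_card_mono) auto
    moreover have "finite_connected_simple_graph V E1"
      using slides_invariants[OF r_into_rtranclp[of "slide V", OF slide]] less.prems by blast
    ultimately obtain E' where "(slide V)\<^sup>*\<^sup>* E1 E'" "dominating V E' v"
      using less.hyps by blast
    then show ?thesis
      using slide by (meson converse_rtranclp_into_rtranclp)
  qed blast
qed

section \<open>Rearranging the edges that avoid a dominating vertex\<close>

text \<open>The edge \<open>{x, v}\<close> first slides to \<open>{x, z}\<close>; then \<open>{x, y}\<close> slides to the vacated \<open>{x, v}\<close>.\<close>

lemma dominating_pivot_move:
  assumes "dominating V E v"
    and "v \<in> V" "x \<in> V" "y \<in> V" "z \<in> V" "distinct [v, x, y, z]"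
    and "{x, y} \<in> E" "{x, z} \<notin> E"
  shows "(slide V)\<^sup>*\<^sup>* E (insert {x, z} (E - {{x, y}}))"
proof -
  let ?E1 = "(E - {{x, v}}) \<union> {{x, z}}"
  let ?E2 = "(?E1 - {{x, y}}) \<union> {{x, v}}"
  have v: "{v, x} \<in> E" "{v, y} \<in> E" "{v, z} \<in> E"
    using assms by (auto simp: dominating_def adj_def)
  have "slide V E ?E1"
    by (rule slide.intros) (use assms v in \<open>auto simp: adj_def insert_commute\<close>)
  moreover have "slide V ?E1 ?E2"
    by (rule slide.intros) (use assms v in \<open>auto simp: adj_def doubleton_eq_iff insert_commute\<close>)
  moreover have "{x, v} \<in> E" "{x, z} \<noteq> {x, y}" "{x, v} \<noteq> {x, y}"
    using assms v by (auto simp: doubleton_eq_iff insert_commute)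
  then have "?E2 = insert {x, z} (E - {{x, y}})"
    by blast
  ultimately show ?thesis
    by (metis converse_rtranclp_into_rtranclp r_into_rtranclp)
qed

text \<open>Edges at \<open>v\<close> are untouched; this permits a further move through
  \<open>v\<close> after an exchange.\<close>

lemma dominating_exchange:
  assumes "dominating V E v" "v \<notin> e" "v \<notin> f"
  shows "dominating V (insert f (E - {e})) v"
  using assms by (auto simp: dominating_def adj_def)

text \<open>
  When \<open>{a, b}\<close> and \<open>{c, d}\<close> are disjoint, both moves pass through \<open>{a, c}\<close>; if that is already an
  edge, it is moved to \<open>{c, d}\<close> first and then replaced by \<open>{a, b}\<close>.
\<close>

lemma dominating_edge_move:
  assumes dom: "dominating V E v" and "v \<in> V"
    and e: "a \<in> V" "b \<in> V" "a \<noteq> b" "a \<noteq> v" "b \<noteq> v" "{a, b} \<in> E"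
    and f: "c \<in> V" "d \<in> V" "c \<noteq> d" "c \<noteq> v" "d \<noteq> v" "{c, d} \<notin> E"
  shows "(slide V)\<^sup>*\<^sup>* E (insert {c, d} (E - {{a, b}}))"
proof (cases "{a, b} \<inter> {c, d} = {}")
  case False
  \<comment> \<open>A common endpoint serves as pivot, so one move is enough.\<close>
  then obtain x y z where "{a, b} = {x, y}" "{c, d} = {x, z}"
    by (auto simp: insert_commute)
  moreover from this have "y \<noteq> z"
    using e f by metis
  moreover from calculation have "x \<in> V" "y \<in> V" "z \<in> V" "distinct [v, x, y]" "distinct [v, x, z]"
    using e f by (auto simp: doubleton_eq_iff)
  ultimately show ?thesis
    using dominating_pivot_move[OF dom \<open>v \<in> V\<close>, of x y z] e f by auto
next
  case disj: True
  show ?thesis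
  proof (cases "{a, c} \<in> E")
    case False
    let ?E1 = "insert {a, c} (E - {{a, b}})"
    have "(slide V)\<^sup>*\<^sup>* E ?E1"
      using dominating_pivot_move[OF dom \<open>v \<in> V\<close>, of a b c] e f disj False by auto
    moreover have "dominating V ?E1 v"
      using dominating_exchange[OF dom] e f by auto
    then have "(slide V)\<^sup>*\<^sup>* ?E1 (insert {c, d} (?E1 - {{c, a}}))"
      using e f disj \<open>v \<in> V\<close>
      by (intro dominating_pivot_move[where v = v]) (auto simp: doubleton_eq_iff insert_commute)
    moreover have "insert {c, d} (?E1 - {{c, a}}) = insert {c, d} (E - {{a, b}})"
      using False by (auto simp: insert_commute)
    ultimately show ?thesis
      by simp
  next
    case True
    let ?E1 = "insert {c, d} (E - {{c, a}})"
    have "(slide V)\<^sup>*\<^sup>* E ?E1"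
      using e f disj True \<open>v \<in> V\<close>
      by (intro dominating_pivot_move[OF dom]) (auto simp: insert_commute)
    moreover have "dominating V ?E1 v"
      using dominating_exchange[OF dom] e f by auto
    then have "(slide V)\<^sup>*\<^sup>* ?E1 (insert {a, c} (?E1 - {{a, b}}))"
      using e f disj \<open>v \<in> V\<close>
      by (intro dominating_pivot_move[where v = v]) (auto simp: doubleton_eq_iff insert_commute)
    moreover have "insert {a, c} (?E1 - {{a, b}}) = insert {c, d} (E - {{a, b}})"
      using True e f disj by (auto simp: doubleton_eq_iff insert_commute)
    ultimately show ?thesis
      by simp
  qed
qed

text \<open>Each round trades an edge of \<open>E - F\<close> for one of \<open>F - E\<close>, so
  \<open>card (E - F)\<close> drops; equal edge numbers ensure that both differences are nonempty
  unless \<open>E = F\<close>.\<close>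

lemma dominating_slides:
  assumes "finite V" "v \<in> V" "simple_graph V E" "simple_graph V F"
    and "dominating V E v" "dominating V F v" "card E = card F"
  shows "(slide V)\<^sup>*\<^sup>* E F"
  using assms(3,5,7)
proof (induction "card (E - F)" arbitrary: E rule: less_induct)
  case less
  have fin: "finite E" "finite F"
    using simple_graph_finite assms(1,4) less.prems by blast+
  show ?case
  proof (cases "E \<subseteq> F")
    case True
    then have "E = F"
      using card_subset_eq fin less.prems by blast
    then show ?thesis
      by simp
  next
    case False
    then obtain e where e: "e \<in> E" "e \<notin> F"
      by blast
    have "\<not> F \<subseteq> E"
      using card_subset_eq[of E F] fin less.prems e by auto
    then obtain f where f: "f \<in> F" "f \<notin> E"
      by blast
    obtain a b where ab: "e = {a, b}" "a \<in> V" "b \<in> V" "a \<noteq> b"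
      using simple_graph_edgeE less.prems e by metis
    obtain c d where cd: "f = {c, d}" "c \<in> V" "d \<in> V" "c \<noteq> d"
      using simple_graph_edgeE assms(4) f by metis
    \<comment> \<open>Both graphs contain every possible edge at \<open>v\<close>, so an edge of
      only one of them avoids \<open>v\<close>.\<close>
    have v: "v \<notin> e" "v \<notin> f"
      using e f ab cd assms(6) less.prems
      by (auto simp: dominating_def adj_def insert_commute)
    let ?E1 = "insert f (E - {e})"
    have "(slide V)\<^sup>*\<^sup>* E ?E1"
      using dominating_edge_move[OF less.prems(2) \<open>v \<in> V\<close>] ab cd e f v by auto
    moreover have "(slide V)\<^sup>*\<^sup>* ?E1 F"
    proof (rule less.hyps)
      have "?E1 - F = (E - F) - {e}"
        using f by auto
      then show "card (?E1 - F) < card (E - F)"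
        using e fin card_Diff1_less[of "E - F" e] by simp
      show "simple_graph V ?E1"
        using less.prems(1) assms(4) f by (auto simp: simple_graph_def)
      show "dominating V ?E1 v"
        using dominating_exchange[OF less.prems(2) v] .
      show "card ?E1 = card F"
        using e f fin less.prems card_Suc_Diff1[of E e] by simp
    qed
    ultimately show ?thesis
      by simp
  qed
qed

theorem slides_between_connected_graphs:
  assumes E: "finite_connected_simple_graph V E" and F: "finite_connected_simple_graph V F"
    and card: "card E = card F"
  shows "(slide V)\<^sup>*\<^sup>* E F"
\<comment> \<open>The normal form needs a vertex \<open>v\<close>, so the empty graph is treated
  apart.\<close>
proof (cases "V = {}")
  case True
  then have "E = {}" "F = {}"
    using E F by (auto simp: finite_connected_simple_graph_def simple_graph_def)
  then show ?thesis
    by simp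
next
  case False
  then obtain v where v: "v \<in> V"
    by blast
  obtain E' where E': "(slide V)\<^sup>*\<^sup>* E E'" "dominating V E' v"
    using slides_to_dominating[OF E v] by blast
  obtain F' where F': "(slide V)\<^sup>*\<^sup>* F F'" "dominating V F' v"
    using slides_to_dominating[OF F v] by blast
  \<comment> \<open>Slides preserve the number of edges, so \<open>E'\<close> and \<open>F'\<close>
    again have equally many.\<close>
  have "(slide V)\<^sup>*\<^sup>* E' F'"
    using slides_invariants[OF E'(1) E] slides_invariants[OF F'(1) F] E' F' v card
    by (intro dominating_slides) (auto simp: finite_connected_simple_graph_def)
  then show ?thesis
    using E'(1) slides_sym[OF F'(1)] by (meson rtranclp_trans)
qed

section \<open>Transport along a bijection of vertex sets\<close>

lemma transport_graph:
  assumes F: "finite_connected_simple_graph W F" and bij: "bij_betw \<phi> W V"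
  shows "finite_connected_simple_graph V ((`) \<phi> ` F)" "card ((`) \<phi> ` F) = card F"
proof -
  let ?F = "(`) \<phi> ` F"
  note F' = F[unfolded finite_connected_simple_graph_def]
  have inj: "inj_on \<phi> W" and im: "\<phi> ` W = V"
    using bij by (auto simp: bij_betw_def)
  have "F \<subseteq> Pow W"
    using F' by (auto simp: simple_graph_def)
  then show "card ?F = card F"
    \<comment> \<open>A map injective on \<open>W\<close> acts injectively on the subsets of
      \<open>W\<close>, in particular on edges.\<close>
    using inj by (intro card_image) (meson inj_on_image_Pow inj_on_subset)
  have "simple_graph V ?F"
    unfolding simple_graph_def
  proof
    fix e assume "e \<in> ?F"
    then obtain x y where "e = {\<phi> x, \<phi> y}" "x \<in> W" "y \<in> W" "x \<noteq> y"
      using F' by (auto elim!: simple_graph_edgeE)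
    moreover from this have "\<phi> x \<in> V" "\<phi> y \<in> V" "\<phi> x \<noteq> \<phi> y"
      using inj im by (auto simp: inj_on_eq_iff)
    ultimately show "e \<in> {{x, y} |x y. x \<in> V \<and> y \<in> V \<and> x \<noteq> y}"
      by blast
  qed
  moreover have "connected_graph V ?F"
  proof -
    have step: "adj ?F (\<phi> x) (\<phi> y)" if "adj F x y" for x y
      using imageI[of "{x, y}" F "(`) \<phi>"] that by (simp add: adj_def)
    have "(adj ?F)\<^sup>*\<^sup>* (\<phi> x) (\<phi> y)" if "(adj F)\<^sup>*\<^sup>* x y" for x y
      using that by induction (auto dest: step)
    then show ?thesis
      using F' im unfolding connected_graph_def by blast
  qed
  ultimately show "finite_connected_simple_graph V ?F"
    using F' im by (auto simp: finite_connected_simple_graph_def)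
qed

theorem theorem3p1:
  fixes V :: "'a set" and E :: "'a set set"
    and W :: "'b set" and F :: "'b set set"
    and \<psi> :: "'a \<Rightarrow> 'b"
  assumes "finite_connected_simple_graph V E"
    and "finite_connected_simple_graph W F"
    and "card V = card W"
    and "card E = card F"
    and "bij_betw \<psi> V W"
  shows "\<exists>E'. (slide V)\<^sup>*\<^sup>* E E' \<and> simple_graph V E' \<and> graph_iso \<psi> V E' W F"
proof -
  define \<phi> where "\<phi> = inv_into V \<psi>"
  \<comment> \<open>The target of the slides is the second graph pulled back to \<open>V\<close>,
    which makes \<psi> an isomorphism by construction.\<close>
  define E' where "E' = (`) \<phi> ` F"
  have bij: "bij_betw \<phi> W V"
    unfolding \<phi>_def using assms(5) by (rule bij_betw_inv_into)
  have left: "\<phi> (\<psi> x) = x" if "x \<in> V" for x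
    using that assms(5) by (simp add: \<phi>_def bij_betw_inv_into_left)
  have right: "\<psi> (\<phi> w) = w" if "w \<in> W" for w
    using that assms(5) by (simp add: \<phi>_def bij_betw_inv_into_right)
  have E': "finite_connected_simple_graph V E'" "card E' = card F"
    unfolding E'_def using transport_graph[OF assms(2) bij] by auto
  have "adj E' x y \<longleftrightarrow> adj F (\<psi> x) (\<psi> y)" if "x \<in> V" "y \<in> V" for x y
  proof
    assume "adj E' x y"
    then obtain g where g: "g \<in> F" "{x, y} = \<phi> ` g"
      by (auto simp: adj_def E'_def)
    \<comment> \<open>Needed because \<phi> is known to be undone by \<psi> only on
      \<open>W\<close>.\<close>
    have "g \<subseteq> W"
      using g assms(2) by (auto simp: finite_connected_simple_graph_def simple_graph_def)
    then have "\<psi> ` \<phi> ` g = g"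
      using right by (force simp: image_image)
    then have "{\<psi> x, \<psi> y} = g"
      using g(2) by (metis image_empty image_insert)
    then show "adj F (\<psi> x) (\<psi> y)"
      using g by (simp add: adj_def)
  next
    assume "adj F (\<psi> x) (\<psi> y)"
    then have "\<phi> ` {\<psi> x, \<psi> y} \<in> E'"
      unfolding adj_def E'_def by (rule imageI)
    then show "adj E' x y"
      using that left by (simp add: adj_def)
  qed
  then have "graph_iso \<psi> V E' W F"
    using assms(5) by (simp add: graph_iso_def)
  moreover have "(slide V)\<^sup>*\<^sup>* E E'"
    using slides_between_connected_graphs assms E' by metis
  ultimately show ?thesis
    using E' unfolding finite_connected_simple_graph_def by blast
qed

end
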